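(* Let $E$ and $F$ be Banach lattices and let $A$ be a (norm) bounded solid subset of $E$. The following statements hold. (1) Let $T:E\to F$ be a continuous operator. If $Tx_n\xrightarrow{un}0$ (i.e. $\rho_v(Tx_n)=\big\||Tx_n|\wedge v\big\|\to 0$ for all $v\in F_+$) for every disjoint sequence $(x_n)\subset A$, then for each $\epsilon>0$ and $v\in F_+$ there exists some $u\in E_+$ lying in the ideal generated by $A$ such that $\rho_v\big(T((|x|-u)^+)\big)<\epsilon$ for all $x\in A$. (2) Let $T:E\to F$ be a continuous operator. If $Tx_n\xrightarrow{uaw}0$ (i.e. $\rho_{v,y'}(Tx_n)=y'(|Tx_n|\wedge v)\to 0$ for all $v\in F_+$, $y'\in F'_+$) for every disjoint sequence $(x_n)\subset A$, then for each $\epsilon>0$, $v\in F_+$ and $y'\in F'_+$ there exists some $u\in E_+$ lying in the ideal generated by $A$ such that $\rho_{v,y'}\big(T((|x|-u)^+)\big)<\epsilon$ for all $x\in A$. (3) Let $T:E\to F'$ be a continuous operator into the dual Banach lattice $F'$. If $Tx_n\xrightarrow{uaw^*}0$ (i.e. $\rho_{v',y}(Tx_n)=(|Tx_n|\wedge v')(y)\to 0$ for all $v'\in F'_+$, $y\in F_+$) for every disjoint sequence $(x_n)\subset A$, then for each $\epsilon>0$, $v'\in F'_+$ and $y\in F_+$ there exists some $u\in E_+$ lying in the ideal generated by $A$ such that $\rho_{v',y}\big(T((|x|-u)^+)\big)<\epsilon$ for all $x\in A$.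
   Context: Operators are linear; a continuous operator between Banach lattices is a norm-continuous (bounded) linear operator. $E_+=\{x\in E:x\ge0\}$; $x^+=x\vee 0$; $F'$ denotes the norm dual of $F$, a Banach lattice, with positive cone $F'_+$. A set $A\subset E$ is solid if $|x|\le|y|$ and $y\in A$ imply $x\in A$. A sequence $(x_n)$ is disjoint if $|x_n|\wedge|x_m|=0$ for $n\neq m$. The functions used are $\rho_v(z)=\||z|\wedge v\|$ and $\rho_{v,y'}(z)=y'(|z|\wedge v)$ for $z\in F$, and $\rho_{v',y}(z')=(|z'|\wedge v')(y)$ for $z'\in F'$. *)

theory Defs
  imports "HOL-Analysis.Analysis" "HOL-Library.Lattice_Algebras"
begin

section \<open>Banach lattices\<close>

class banach_lattice = banach + ordered_real_vector + lattice_ab_group_add_abs +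
  assumes norm_mono_abs: "\<bar>x\<bar> \<le> \<bar>y\<bar> \<Longrightarrow> norm x \<le> norm y"

instance real :: banach_lattice
  by standard simp

definition solid :: "'a::banach_lattice set \<Rightarrow> bool" where
  "solid A \<longleftrightarrow> (\<forall>x y. y \<in> A \<longrightarrow> \<bar>x\<bar> \<le> \<bar>y\<bar> \<longrightarrow> x \<in> A)"

definition disjoint_seq :: "(nat \<Rightarrow> 'a::banach_lattice) \<Rightarrow> bool" where
  "disjoint_seq x \<longleftrightarrow> (\<forall>n m. n \<noteq> m \<longrightarrow> inf \<bar>x n\<bar> \<bar>x m\<bar> = 0)"

definition order_ideal :: "'a::banach_lattice set \<Rightarrow> bool" where
  "order_ideal I \<longleftrightarrow> subspace I \<and> solid I"

definition ideal_generated :: "'a::banach_lattice set \<Rightarrow> 'a set" where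
  "ideal_generated A = order_ideal hull A"


section \<open>The norm dual\<close>

text \<open>A copy of the space of bounded linear functionals. A separate type is needed because the
  lattice structure exists for real-valued functionals and not for general bounded operators.\<close>

typedef (overloaded) 'a dual = "UNIV :: ('a::real_normed_vector \<Rightarrow>\<^sub>L real) set"
  morphisms blinfun_of_dual dual_of_blinfun
  by simp

setup_lifting type_definition_dual

definition dual_apply :: "'a::real_normed_vector dual \<Rightarrow> 'a \<Rightarrow> real" where
  "dual_apply f x = blinfun_apply (blinfun_of_dual f) x"

lemma dual_eqI: "(\<And>x. dual_apply f x = dual_apply g x) \<Longrightarrow> f = g"
  unfolding dual_apply_def by transfer (rule blinfun_eqI)

instantiation dual :: (real_normed_vector) real_normed_vector
begin

lift_definition zero_dual :: "'a dual" is 0 .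
lift_definition plus_dual :: "'a dual \<Rightarrow> 'a dual \<Rightarrow> 'a dual" is "(+)" .
lift_definition minus_dual :: "'a dual \<Rightarrow> 'a dual \<Rightarrow> 'a dual" is "(-)" .
lift_definition uminus_dual :: "'a dual \<Rightarrow> 'a dual" is uminus .
lift_definition scaleR_dual :: "real \<Rightarrow> 'a dual \<Rightarrow> 'a dual" is scaleR .
lift_definition norm_dual :: "'a dual \<Rightarrow> real" is norm .
lift_definition sgn_dual :: "'a dual \<Rightarrow> 'a dual" is sgn .
lift_definition dist_dual :: "'a dual \<Rightarrow> 'a dual \<Rightarrow> real" is dist .

definition uniformity_dual :: "('a dual \<times> 'a dual) filter" where
  "uniformity_dual = (INF e\<in>{0<..}. principal {(x, y). dist x y < e})"

definition open_dual :: "'a dual set \<Rightarrow> bool" where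
  "open_dual U \<longleftrightarrow> (\<forall>x\<in>U. \<forall>\<^sub>F (x', y) in uniformity. x' = x \<longrightarrow> y \<in> U)"

instance
proof
  show "dist x y = norm (x - y)" for x y :: "'a dual"
    by transfer (rule dist_norm)
  show "sgn x = scaleR (inverse (norm x)) x" for x :: "'a dual"
    by transfer (rule sgn_div_norm)
  show "norm (x + y) \<le> norm x + norm y" for x y :: "'a dual"
    by transfer (rule norm_triangle_ineq)
  show "uniformity = (INF e\<in>{0<..}. principal {(x :: 'a dual, y). dist x y < e})"
    by (rule uniformity_dual_def)
  show "open U \<longleftrightarrow> (\<forall>x\<in>U. \<forall>\<^sub>F (x', y) in uniformity. x' = x \<longrightarrow> y \<in> U)" for U :: "'a dual set"
    by (rule open_dual_def)
qed (transfer; simp add: algebra_simps)+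

end

instance dual :: (real_normed_vector) banach
proof
  fix X :: "nat \<Rightarrow> 'a dual"
  assume X: "Cauchy X"
  have dist: "dist (blinfun_of_dual f) (blinfun_of_dual g) = dist f g" for f g :: "'a dual"
    by transfer simp
  have "Cauchy (\<lambda>n. blinfun_of_dual (X n))"
    using X unfolding Cauchy_def dist .
  then obtain L where "(\<lambda>n. blinfun_of_dual (X n)) \<longlonglongrightarrow> L"
    using Cauchy_convergent convergent_def by blast
  then have "(\<lambda>n. dist (blinfun_of_dual (X n)) (blinfun_of_dual (dual_of_blinfun L))) \<longlonglongrightarrow> 0"
    by (simp only: dual_of_blinfun_inverse[OF UNIV_I] tendsto_dist_iff[symmetric])
  then have "X \<longlonglongrightarrow> dual_of_blinfun L"
    unfolding dist by (rule iffD2[OF tendsto_dist_iff])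
  then show "convergent X"
    by (auto simp: convergent_def)
qed

lemma dual_apply_simps [simp]:
  "dual_apply 0 x = 0"
  "dual_apply (f + g) x = dual_apply f x + dual_apply g x"
  "dual_apply (f - g) x = dual_apply f x - dual_apply g x"
  "dual_apply (- f) x = - dual_apply f x"
  "dual_apply (c *\<^sub>R f) x = c * dual_apply f x"
  by (simp_all add: dual_apply_def zero_dual.rep_eq plus_dual.rep_eq minus_dual.rep_eq
      uminus_dual.rep_eq scaleR_dual.rep_eq blinfun.bilinear_simps)

lemma bounded_linear_dual_apply: "bounded_linear (dual_apply f)"
  unfolding dual_apply_def[abs_def] by (rule blinfun.bounded_linear_right)

lemma dual_apply_right:
  "dual_apply f 0 = 0"
  "dual_apply f (x + y) = dual_apply f x + dual_apply f y"
  "dual_apply f (x - y) = dual_apply f x - dual_apply f y"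
  "dual_apply f (- x) = - dual_apply f x"
  "dual_apply f (c *\<^sub>R x) = c * dual_apply f x"
  by (simp_all add: dual_apply_def blinfun.bilinear_simps)

lemma abs_dual_apply_le: "\<bar>dual_apply f x\<bar> \<le> norm f * norm x"
  unfolding dual_apply_def norm_dual.rep_eq using norm_blinfun[of "blinfun_of_dual f" x] by simp

lemma norm_dual_bound:
  assumes "0 \<le> b" "\<And>x. \<bar>dual_apply f x\<bar> \<le> b * norm x"
  shows "norm f \<le> b"
  unfolding norm_dual.rep_eq using assms
  by (intro norm_blinfun_bound) (simp_all add: dual_apply_def)


section \<open>The dual of a Banach lattice is a Banach lattice\<close>

lemma norm_mono_pos: "0 \<le> x \<Longrightarrow> x \<le> y \<Longrightarrow> norm x \<le> norm (y :: 'a::banach_lattice)"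
  by (rule norm_mono_abs) auto

lemma norm_abs_eq: "norm \<bar>x\<bar> = norm (x :: 'a::banach_lattice)"
  by (rule antisym; rule norm_mono_abs) simp_all

lemma pprt_le_abs: "pprt x \<le> \<bar>x :: 'a::banach_lattice\<bar>"
  and minus_nprt_le_abs: "- nprt x \<le> \<bar>x\<bar>"
  by (simp_all add: abs_prts)

text \<open>The Riesz--Kantorovich formula for the positive part of a functional, on the cone and then
  on the whole space.\<close>

definition rk_cone :: "'a::banach_lattice dual \<Rightarrow> 'a \<Rightarrow> real" where
  "rk_cone f x = (SUP y\<in>{0..x}. dual_apply f y)"

definition rk_pos :: "'a::banach_lattice dual \<Rightarrow> 'a \<Rightarrow> real" where
  "rk_pos f x = rk_cone f (pprt x) - rk_cone f (- nprt x)"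

definition dual_pos :: "'a::banach_lattice dual \<Rightarrow> 'a dual" where
  "dual_pos f = dual_of_blinfun (Blinfun (rk_pos f))"

lemma dual_apply_le_interval:
  assumes "0 \<le> y" "y \<le> x"
  shows "dual_apply f y \<le> norm f * norm (x :: 'a::banach_lattice)"
proof -
  have "dual_apply f y \<le> norm f * norm y"
    using abs_dual_apply_le[of f y] by simp
  also have "\<dots> \<le> norm f * norm x"
    using assms by (intro mult_left_mono norm_mono_pos) auto
  finally show ?thesis .
qed

lemma rk_cone_upper: "0 \<le> y \<Longrightarrow> y \<le> x \<Longrightarrow> dual_apply f y \<le> rk_cone f x"
  unfolding rk_cone_def
  by (rule cSUP_upper) (auto intro!: bdd_aboveI dual_apply_le_interval)

lemma rk_cone_least:
  "0 \<le> x \<Longrightarrow> (\<And>y. 0 \<le> y \<Longrightarrow> y \<le> x \<Longrightarrow> dual_apply f y \<le> b) \<Longrightarrow> rk_cone f x \<le> b"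
  unfolding rk_cone_def by (rule cSUP_least) auto

lemma rk_cone_nonneg: "0 \<le> x \<Longrightarrow> 0 \<le> rk_cone f x"
  using rk_cone_upper[of 0 x f] by (simp add: dual_apply_right)

lemma rk_cone_add:
  assumes x: "0 \<le> x" and y: "0 \<le> y"
  shows "rk_cone f (x + y) = rk_cone f x + rk_cone f y"
proof (rule antisym)
  show "rk_cone f (x + y) \<le> rk_cone f x + rk_cone f y"
  proof (rule rk_cone_least)
    fix z assume z: "0 \<le> z" "z \<le> x + y"
    have "z - inf z x = sup 0 (z - x)"
      by (simp add: diff_inf_eq_sup add_sup_distrib_left)
    moreover have "z - x \<le> y"
      using z by (simp add: algebra_simps)
    ultimately have "0 \<le> z - inf z x" "z - inf z x \<le> y"
      using y by simp_all
    then have "dual_apply f (inf z x) \<le> rk_cone f x" "dual_apply f (z - inf z x) \<le> rk_cone f y"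
      using z x by (auto intro!: rk_cone_upper)
    then show "dual_apply f z \<le> rk_cone f x + rk_cone f y"
      unfolding dual_apply_right(3) by linarith
  qed (use x y in simp)
  have "rk_cone f x \<le> rk_cone f (x + y) - rk_cone f y"
  proof (rule rk_cone_least[OF x])
    fix a assume a: "0 \<le> a" "a \<le> x"
    have "rk_cone f y \<le> rk_cone f (x + y) - dual_apply f a"
    proof (rule rk_cone_least[OF y])
      fix b assume b: "0 \<le> b" "b \<le> y"
      have "dual_apply f (a + b) \<le> rk_cone f (x + y)"
        using a b by (intro rk_cone_upper add_mono) auto
      then show "dual_apply f b \<le> rk_cone f (x + y) - dual_apply f a"
        by (simp add: dual_apply_right)
    qed
    then show "dual_apply f a \<le> rk_cone f (x + y) - rk_cone f y" by simp
  qed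
  then show "rk_cone f x + rk_cone f y \<le> rk_cone f (x + y)" by simp
qed

lemma rk_cone_scale:
  assumes x: "0 \<le> x" and c: "0 \<le> c"
  shows "rk_cone f (c *\<^sub>R x) = c * rk_cone f x"
proof (cases "c = 0")
  case True
  then show ?thesis by (simp add: rk_cone_def dual_apply_right)
next
  case False
  with c have c: "0 < c" by simp
  have le: "rk_cone f (d *\<^sub>R z) \<le> d * rk_cone f z" if d: "0 < d" and z: "0 \<le> z" for d z
  proof (rule rk_cone_least)
    fix y assume y: "0 \<le> y" "y \<le> d *\<^sub>R z"
    have "(1 / d) *\<^sub>R y \<le> (1 / d) *\<^sub>R (d *\<^sub>R z)"
      using y d by (intro scaleR_left_mono) auto
    then have "dual_apply f ((1 / d) *\<^sub>R y) \<le> rk_cone f z"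
      using y d by (intro rk_cone_upper) (auto intro: scaleR_nonneg_nonneg)
    then show "dual_apply f y \<le> d * rk_cone f z"
      using d by (simp add: dual_apply_right field_simps)
  qed (use d z in \<open>auto intro: scaleR_nonneg_nonneg\<close>)
  have "rk_cone f ((1 / c) *\<^sub>R (c *\<^sub>R x)) \<le> (1 / c) * rk_cone f (c *\<^sub>R x)"
    using c x by (intro le) (auto intro: scaleR_nonneg_nonneg)
  then have "c * rk_cone f x \<le> rk_cone f (c *\<^sub>R x)"
    using c by (simp add: field_simps)
  with le[OF c x] show ?thesis by simp
qed

lemma rk_pos_diff:
  assumes a: "0 \<le> a" and b: "0 \<le> b"
  shows "rk_pos f (a - b) = rk_cone f a - rk_cone f b"
proof -
  have "pprt (a - b) + b = a + (- nprt (a - b))"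
    using prts[of "a - b"] by (simp add: algebra_simps)
  then have "rk_cone f (pprt (a - b)) + rk_cone f b = rk_cone f a + rk_cone f (- nprt (a - b))"
    using a b rk_cone_add[of "pprt (a - b)" b f] rk_cone_add[of a "- nprt (a - b)" f] by simp
  then show ?thesis by (simp add: rk_pos_def)
qed

lemma rk_pos_cone: "0 \<le> x \<Longrightarrow> rk_pos f x = rk_cone f x"
  using rk_pos_diff[of x 0 f] by (simp add: rk_cone_def dual_apply_right)

lemma bounded_linear_rk_pos: "bounded_linear (rk_pos f)"
proof (rule bounded_linear_intro)
  fix x y :: 'a and c :: real
  have dec: "z = pprt z - (- nprt z)" for z :: 'a
    using prts[of z] by simp
  have "x + y = (pprt x + pprt y) - (- nprt x + - nprt y)"
    using arg_cong2[OF prts prts, of "(+)" x y] by (simp add: algebra_simps)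
  then have "rk_pos f (x + y) = rk_cone f (pprt x + pprt y) - rk_cone f (- nprt x + - nprt y)"
    using rk_pos_diff[of "pprt x + pprt y" "- nprt x + - nprt y" f]
    by (simp only: add_nonneg_nonneg neg_0_le_iff_le nprt_le_zero zero_le_pprt)
  also have "\<dots> = rk_cone f (pprt x) + rk_cone f (pprt y)
      - (rk_cone f (- nprt x) + rk_cone f (- nprt y))"
    using rk_cone_add[of "pprt x" "pprt y" f] rk_cone_add[of "- nprt x" "- nprt y" f] by simp
  finally show "rk_pos f (x + y) = rk_pos f x + rk_pos f y"
    by (simp add: rk_pos_def)
  show "rk_pos f (c *\<^sub>R x) = c *\<^sub>R rk_pos f x"
  proof (cases "0 \<le> c")
    case True
    have "c *\<^sub>R x = c *\<^sub>R pprt x - c *\<^sub>R (- nprt x)"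
      using arg_cong[OF dec, of "scaleR c" x] by (simp only: scaleR_diff_right)
    also have "rk_pos f \<dots> = rk_cone f (c *\<^sub>R pprt x) - rk_cone f (c *\<^sub>R (- nprt x))"
      using True by (intro rk_pos_diff scaleR_nonneg_nonneg) auto
    also have "\<dots> = c * rk_cone f (pprt x) - c * rk_cone f (- nprt x)"
      using True rk_cone_scale[of "pprt x" c f] rk_cone_scale[of "- nprt x" c f] by simp
    finally show ?thesis by (simp add: rk_pos_def algebra_simps)
  next
    case False
    have "c *\<^sub>R x = (- c) *\<^sub>R (- nprt x) - (- c) *\<^sub>R pprt x"
      using arg_cong[OF dec, of "scaleR c" x] by (simp add: scaleR_diff_right scaleR_add_right)
    also have "rk_pos f \<dots> = rk_cone f ((- c) *\<^sub>R (- nprt x)) - rk_cone f ((- c) *\<^sub>R pprt x)"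
      using False by (intro rk_pos_diff scaleR_nonneg_nonneg) auto
    also have "\<dots> = (- c) * rk_cone f (- nprt x) - (- c) * rk_cone f (pprt x)"
      using False rk_cone_scale[of "pprt x" "- c" f] rk_cone_scale[of "- nprt x" "- c" f]
      by (simp del: scaleR_minus_left scaleR_minus_right)
    finally show ?thesis by (simp add: rk_pos_def algebra_simps)
  qed
  have bd: "0 \<le> rk_cone f z \<and> rk_cone f z \<le> norm f * norm x" if "0 \<le> z" "z \<le> \<bar>x\<bar>" for z
    using that norm_abs_eq[of x] dual_apply_le_interval[of _ "\<bar>x\<bar>" f]
    by (auto intro!: rk_cone_nonneg rk_cone_least)
  have "\<bar>rk_pos f x\<bar> \<le> norm f * norm x"
    using bd[of "pprt x"] bd[of "- nprt x"] pprt_le_abs[of x] minus_nprt_le_abs[of x]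
    by (simp add: rk_pos_def abs_le_iff)
  then show "norm (rk_pos f x) \<le> norm x * norm f"
    by (simp add: mult.commute)
qed

lemma dual_apply_dual_pos: "0 \<le> x \<Longrightarrow> dual_apply (dual_pos f) x = rk_cone f x"
  by (simp add: dual_apply_def dual_pos_def dual_of_blinfun_inverse bounded_linear_Blinfun_apply
      bounded_linear_rk_pos rk_pos_cone)

text \<open>The order is the pointwise order on the positive cone. The lattice operations and the modulus
  are determined by it, as the instance proof shows; they are not pointwise.\<close>

instantiation dual :: (banach_lattice) banach_lattice
begin

definition less_eq_dual :: "'a dual \<Rightarrow> 'a dual \<Rightarrow> bool" where
  "f \<le> g \<longleftrightarrow> (\<forall>x\<ge>0. dual_apply f x \<le> dual_apply g x)"

definition less_dual :: "'a dual \<Rightarrow> 'a dual \<Rightarrow> bool" where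
  "(f :: 'a dual) < g \<longleftrightarrow> f \<le> g \<and> \<not> g \<le> f"

definition sup_dual :: "'a dual \<Rightarrow> 'a dual \<Rightarrow> 'a dual" where
  "sup (f :: 'a dual) g = f + dual_pos (g - f)"

definition inf_dual :: "'a dual \<Rightarrow> 'a dual \<Rightarrow> 'a dual" where
  "inf (f :: 'a dual) g = - sup (- f) (- g)"

definition abs_dual :: "'a dual \<Rightarrow> 'a dual" where
  "\<bar>f :: 'a dual\<bar> = sup f (- f)"

instance
proof
  fix f g h :: "'a dual" and a b :: real
  show "f < g \<longleftrightarrow> f \<le> g \<and> \<not> g \<le> f" by (rule less_dual_def)
  show "f \<le> f" by (simp add: less_eq_dual_def)
  show "f \<le> h" if "f \<le> g" "g \<le> h"
    using that unfolding less_eq_dual_def by (blast intro: order_trans)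
  show "f = g" if "f \<le> g" "g \<le> f"
  proof (rule dual_eqI)
    fix x :: 'a
    have eq: "dual_apply f z = dual_apply g z" if "0 \<le> z" for z
      using that \<open>f \<le> g\<close> \<open>g \<le> f\<close> by (auto simp: less_eq_dual_def intro: antisym)
    have "dual_apply f (pprt x - (- nprt x)) = dual_apply g (pprt x - (- nprt x))"
      using eq[of "pprt x"] eq[of "- nprt x"] unfolding dual_apply_right(3) by simp
    then show "dual_apply f x = dual_apply g x"
      using prts[of x] by simp
  qed
  show "h + f \<le> h + g" if "f \<le> g"
    using that by (simp add: less_eq_dual_def)
  show "a *\<^sub>R f \<le> a *\<^sub>R g" if "f \<le> g" "0 \<le> a"
    using that by (auto simp: less_eq_dual_def intro: mult_left_mono)
  show "a *\<^sub>R f \<le> b *\<^sub>R f" if "a \<le> b" "0 \<le> f"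
    using that by (auto simp: less_eq_dual_def intro: mult_right_mono)
  have sup1: "f \<le> sup f g" for f g :: "'a dual"
    by (simp add: less_eq_dual_def sup_dual_def dual_apply_dual_pos rk_cone_nonneg)
  have sup2: "g \<le> sup f g" for f g :: "'a dual"
    unfolding less_eq_dual_def
  proof (intro allI impI)
    fix x :: 'a assume x: "0 \<le> x"
    show "dual_apply g x \<le> dual_apply (sup f g) x"
      using x rk_cone_upper[of x x "g - f"] by (simp add: sup_dual_def dual_apply_dual_pos)
  qed
  have sup3: "sup f g \<le> h" if "f \<le> h" "g \<le> h" for f g h :: "'a dual"
    unfolding less_eq_dual_def
  proof (intro allI impI)
    fix x :: 'a assume x: "0 \<le> x"
    have "rk_cone (g - f) x \<le> dual_apply h x - dual_apply f x"
    proof (rule rk_cone_least[OF x])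
      fix y assume y: "0 \<le> y" "y \<le> x"
      have "dual_apply g y \<le> dual_apply h y" "dual_apply f (x - y) \<le> dual_apply h (x - y)"
        using that y by (auto simp: less_eq_dual_def)
      then show "dual_apply (g - f) y \<le> dual_apply h x - dual_apply f x"
        by (simp add: dual_apply_right)
    qed
    then show "dual_apply (sup f g) x \<le> dual_apply h x"
      using x by (simp add: sup_dual_def dual_apply_dual_pos)
  qed
  show "f \<le> sup f g" "g \<le> sup f g" by (rule sup1 sup2)+
  show "sup g h \<le> f" if "g \<le> f" "h \<le> f" using that by (rule sup3)
  have neg: "- f \<le> g \<longleftrightarrow> - g \<le> f" "f \<le> - g \<longleftrightarrow> g \<le> - f" for f g :: "'a dual"
    by (auto simp: less_eq_dual_def)
  show "inf f g \<le> f" "inf f g \<le> g"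
    unfolding inf_dual_def by (subst neg(1), rule sup1 sup2)+
  show "f \<le> inf g h" if "f \<le> g" "f \<le> h"
    unfolding inf_dual_def
    by (subst neg(2), rule sup3) (use that in \<open>auto simp: less_eq_dual_def\<close>)
  show "\<bar>f\<bar> = sup f (- f)" by (rule abs_dual_def)
  show "norm f \<le> norm g" if le: "\<bar>f\<bar> \<le> \<bar>g\<bar>"
  proof (rule norm_dual_bound)
    fix x :: 'a
    have low: "dual_apply f z \<le> dual_apply \<bar>f\<bar> z" "- dual_apply f z \<le> dual_apply \<bar>f\<bar> z"
      if "0 \<le> z" for z
      using that sup1[of f "- f"] sup2[of "- f" f] by (auto simp: abs_dual_def less_eq_dual_def)
    have "dual_apply f x = dual_apply f (pprt x) - dual_apply f (- nprt x)"
      using arg_cong[OF prts, of "dual_apply f" x] by (simp add: dual_apply_right)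
    moreover have "dual_apply \<bar>f\<bar> \<bar>x\<bar> = dual_apply \<bar>f\<bar> (pprt x) + dual_apply \<bar>f\<bar> (- nprt x)"
      by (simp add: abs_prts dual_apply_right)
    ultimately have "\<bar>dual_apply f x\<bar> \<le> dual_apply \<bar>f\<bar> \<bar>x\<bar>"
      using low[of "pprt x"] low[of "- nprt x"] by (simp add: abs_le_iff)
    also have "\<dots> \<le> dual_apply \<bar>g\<bar> \<bar>x\<bar>"
      using le by (simp add: less_eq_dual_def)
    also have "\<dots> = dual_apply g \<bar>x\<bar> + rk_cone (- g - g) \<bar>x\<bar>"
      by (simp add: abs_dual_def sup_dual_def dual_apply_dual_pos)
    also have "rk_cone (- g - g) \<bar>x\<bar> \<le> norm g * norm x - dual_apply g \<bar>x\<bar>"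
    proof (rule rk_cone_least)
      fix y assume y: "0 \<le> y" "y \<le> \<bar>x\<bar>"
      let ?w = "\<bar>x\<bar> - y - y"
      have "?w \<le> \<bar>x\<bar>" "- ?w \<le> \<bar>x\<bar>"
        using y add_mono[OF y(2) y(2)] add_mono[OF y(1) y(1)] by (simp_all add: algebra_simps)
      then have "\<bar>?w\<bar> \<le> \<bar>x\<bar>" by (rule abs_leI)
      then have "norm ?w \<le> norm x" by (rule norm_mono_abs)
      then have "norm g * norm ?w \<le> norm g * norm x"
        by (intro mult_left_mono) auto
      then have "dual_apply g ?w \<le> norm g * norm x"
        using abs_dual_apply_le[of g ?w] by simp
      then show "dual_apply (- g - g) y \<le> norm g * norm x - dual_apply g \<bar>x\<bar>"
        by (simp add: dual_apply_right)
    qed simp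
    finally show "\<bar>dual_apply f x\<bar> \<le> norm g * norm x" by simp
  qed simp
qed

end


section \<open>The functionals measuring unbounded convergence\<close>

definition rho_un :: "'b::banach_lattice \<Rightarrow> 'b \<Rightarrow> real" where
  "rho_un v z = norm (inf \<bar>z\<bar> v)"

definition rho_uaw :: "'b::banach_lattice \<Rightarrow> 'b dual \<Rightarrow> 'b \<Rightarrow> real" where
  "rho_uaw v y' z = dual_apply y' (inf \<bar>z\<bar> v)"

definition rho_uaws :: "'b::banach_lattice dual \<Rightarrow> 'b \<Rightarrow> 'b dual \<Rightarrow> real" where
  "rho_uaws v' y z' = dual_apply (inf \<bar>z'\<bar> v') y"

text \<open>Convergence to zero in the un-, uaw- and uaw*-sense.\<close>

definition un_null :: "(nat \<Rightarrow> 'b::banach_lattice) \<Rightarrow> bool" where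
  "un_null z \<longleftrightarrow> (\<forall>v\<ge>0. (\<lambda>n. rho_un v (z n)) \<longlonglongrightarrow> 0)"

definition uaw_null :: "(nat \<Rightarrow> 'b::banach_lattice) \<Rightarrow> bool" where
  "uaw_null z \<longleftrightarrow> (\<forall>v\<ge>0. \<forall>y'\<ge>0. (\<lambda>n. rho_uaw v y' (z n)) \<longlonglongrightarrow> 0)"

definition uaws_null :: "(nat \<Rightarrow> 'b::banach_lattice dual) \<Rightarrow> bool" where
  "uaws_null z' \<longleftrightarrow> (\<forall>v'\<ge>0. \<forall>y\<ge>0. (\<lambda>n. rho_uaws v' y (z' n)) \<longlonglongrightarrow> 0)"

end

theory Submission
  imports Defs
begin

text \<open>All three parts are one statement about a function \<open>\<rho>\<close> on \<open>E\<close>, obtained by composing \<open>T\<close> with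
  one of the functionals measuring unbounded convergence. Two properties of \<open>\<rho>\<close> carry the argument:
  it is subadditive, because \<open>\<bar>a + b\<bar> \<and> v \<le> \<bar>a\<bar> \<and> v + \<bar>b\<bar> \<and> v\<close> (\<open>inf_abs_add_le\<close>), and it is bounded
  above by a multiple of the norm. The common statement is \<open>subadditive_small_off_ideal\<close>.

  If no \<open>u\<close> in the ideal works for some \<open>\<epsilon>\<close>, then one chooses recursively positive \<open>y\<^sub>n \<in> A\<close> such that,
  with \<open>s\<^sub>n = s\<^sub>0 + y\<^sub>0 + \<dots> + y\<^sub>n\<^sub>-\<^sub>1\<close> for some \<open>s\<^sub>0 \<ge> 0\<close> in the ideal, the vector \<open>w\<^sub>n = (y\<^sub>n - 4\<^sup>n s\<^sub>n)\<^sup>+\<close> satisfies \<open>\<rho> w\<^sub>n \<ge> \<epsilon>\<close>. The series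
  \<open>z = \<Sum> 2\<^sup>-\<^sup>n y\<^sub>n\<close> converges because \<open>A\<close> is bounded, and the smaller vectors
  \<open>d\<^sub>n = (y\<^sub>n - 4\<^sup>n s\<^sub>n - 2\<^sup>-\<^sup>n z)\<^sup>+\<close> form a disjoint sequence (\<open>disjoint_truncations\<close>): for \<open>m < n\<close>
  the subtracted \<open>4\<^sup>n s\<^sub>n\<close> makes \<open>y\<^sub>n\<close> dominate a large multiple of \<open>y\<^sub>m\<close> wherever \<open>d\<^sub>n\<close> lives, while the
  subtracted \<open>2\<^sup>-\<^sup>m z \<ge> 2\<^sup>-\<^sup>m\<^sup>-\<^sup>n y\<^sub>n\<close> makes the opposite domination hold wherever \<open>d\<^sub>m\<close> lives. Solidity
  puts \<open>d\<^sub>n\<close> into \<open>A\<close>, so \<open>\<rho> d\<^sub>n \<rightarrow> 0\<close>. Since \<open>0 \<le> w\<^sub>n - d\<^sub>n \<le> 2\<^sup>-\<^sup>n z\<close> tends to \<open>0\<close> in norm, also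
  \<open>\<rho> w\<^sub>n\<close> falls below \<open>\<epsilon>\<close>, a contradiction.\<close>


section \<open>Lattice inequalities\<close>

lemma inf_pos_parts_eq_0:
  fixes a b :: "'a::lattice_ab_group_add"
  shows "inf (sup (a - b) 0) (sup (b - a) 0) = 0"
proof -
  have "sup (a - b) 0 = sup a b - b" "sup (b - a) 0 = sup a b - a"
    by (simp_all add: diff_conv_add_uminus add_sup_distrib_right sup_commute del: add_uminus_conv_diff)
  then have "inf (sup (a - b) 0) (sup (b - a) 0) = sup a b - sup b a"
    using add_inf_distrib_left[of "sup a b" "- b" "- a"] neg_sup_eq_inf[of b a] by simp
  then show ?thesis
    by (simp add: sup_commute)
qed

text \<open>Multiplying the second vector by \<open>c \<ge> 1\<close> only enlarges it and turns it into \<open>(c q - p)\<^sup>+\<close>, so the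
  claim reduces to the disjointness of the positive and negative parts of \<open>p - c q\<close>.\<close>

lemma disjoint_pos_parts:
  fixes p q :: "'a::banach_lattice"
  assumes "1 \<le> c"
  shows "inf (sup (p - c *\<^sub>R q) 0) (sup (q - (1 / c) *\<^sub>R p) 0) = 0" (is "inf ?d ?e = 0")
proof (rule antisym)
  have c: "0 < c" using assms by simp
  have "q - (1 / c) *\<^sub>R p \<le> (1 / c) *\<^sub>R sup (c *\<^sub>R q - p) 0"
  proof -
    have "(1 / c) *\<^sub>R (c *\<^sub>R q - p) \<le> (1 / c) *\<^sub>R sup (c *\<^sub>R q - p) 0"
      using c by (intro scaleR_left_mono) auto
    then show ?thesis using c by (simp add: scaleR_diff_right)
  qed
  also have "\<dots> \<le> 1 *\<^sub>R sup (c *\<^sub>R q - p) 0"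
    using assms by (intro scaleR_right_mono) auto
  finally have "?e \<le> sup (c *\<^sub>R q - p) 0" by simp
  then have "inf ?d ?e \<le> inf ?d (sup (c *\<^sub>R q - p) 0)"
    by (intro inf_mono) auto
  then show "inf ?d ?e \<le> 0"
    by (simp only: inf_pos_parts_eq_0)
qed simp

lemma inf_abs_add_le:
  fixes a b v :: "'a::banach_lattice"
  assumes "0 \<le> v"
  shows "inf \<bar>a + b\<bar> v \<le> inf \<bar>a\<bar> v + inf \<bar>b\<bar> v"
proof -
  have "inf \<bar>a + b\<bar> v \<le> \<bar>a\<bar> + \<bar>b\<bar>"
    by (rule le_infI1) (rule abs_triangle_ineq)
  moreover have "inf \<bar>a + b\<bar> v \<le> \<bar>a\<bar> + v" "inf \<bar>a + b\<bar> v \<le> v + \<bar>b\<bar>" "inf \<bar>a + b\<bar> v \<le> v + v"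
    using assms by (auto intro!: le_infI2 simp: add_increasing add_increasing2)
  ultimately show ?thesis
    by (simp add: add_inf_distrib_left add_inf_distrib_right)
qed

lemma norm_inf_abs_le:
  fixes a v :: "'a::banach_lattice"
  assumes "0 \<le> v"
  shows "norm (inf \<bar>a\<bar> v) \<le> norm a"
  using assms by (intro norm_mono_abs) auto

text \<open>The positive cone is norm closed: if \<open>z\<^sub>n \<ge> 0\<close> then the negative part of the limit \<open>z\<close> is at most
  \<open>\<bar>z\<^sub>n - z\<bar>\<close>, hence has arbitrarily small norm.\<close>

lemma limit_nonneg:
  fixes z :: "nat \<Rightarrow> 'a::banach_lattice"
  assumes lim: "z \<longlonglongrightarrow> l" and nonneg: "eventually (\<lambda>n. 0 \<le> z n) sequentially"
  shows "0 \<le> l"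
proof -
  have "eventually (\<lambda>n. norm (sup (- l) 0) \<le> norm (z n - l)) sequentially"
    using nonneg
  proof (rule eventually_mono)
    fix n assume "0 \<le> z n"
    then have "- l \<le> z n - l" by simp
    then have "- l \<le> \<bar>z n - l\<bar>" using abs_ge_self order_trans by blast
    then show "norm (sup (- l) 0) \<le> norm (z n - l)"
      by (intro norm_mono_abs) simp
  qed
  moreover have "(\<lambda>n. norm (z n - l)) \<longlonglongrightarrow> 0"
    using lim by (simp add: LIM_zero tendsto_norm_zero)
  ultimately have "norm (sup (- l) 0) \<le> 0"
    by (intro tendsto_lowerbound) auto
  then have "sup (- l) 0 = 0" by simp
  then show ?thesis by (metis neg_le_0_iff_le sup.cobounded1)
qed

lemma term_le_suminf:
  fixes f :: "nat \<Rightarrow> 'a::banach_lattice"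
  assumes "summable f" and nonneg: "\<And>n. 0 \<le> f n"
  shows "f n \<le> suminf f"
proof -
  have "(\<lambda>k. (\<Sum>i<k. f i) - f n) \<longlonglongrightarrow> suminf f - f n"
    using assms(1) by (intro tendsto_diff tendsto_const summable_LIMSEQ)
  moreover have "eventually (\<lambda>k. 0 \<le> (\<Sum>i<k. f i) - f n) sequentially"
    using eventually_gt_at_top[of n]
  proof (rule eventually_mono)
    fix k assume "n < k"
    then have "(\<Sum>i<k. f i) = f n + (\<Sum>i\<in>{..<k} - {n}. f i)"
      by (intro sum.remove) auto
    then show "0 \<le> (\<Sum>i<k. f i) - f n"
      using nonneg by (simp add: sum_nonneg)
  qed
  ultimately have "0 \<le> suminf f - f n" by (rule limit_nonneg)
  then show ?thesis by simp
qed

lemma order_ideal_ideal_generated: "order_ideal (ideal_generated A)"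
  unfolding ideal_generated_def
  by (rule hull_in) (auto simp: order_ideal_def solid_def subspace_def)


section \<open>Domination modulo the ideal\<close>

text \<open>The recursive choice behind the contradiction: \<open>s n\<close> is a fixed positive start plus the sum
  of the vectors picked so far, and \<open>4\<^sup>n s\<^sub>n\<close>, being an element of the ideal, is the candidate \<open>u\<close>
  refuted by the next pick. Replacing a vector of \<open>A\<close> by its modulus makes all picks positive.\<close>

lemma escaping_partial_sums:
  fixes A :: "'a::banach_lattice set" and \<rho> :: "'a \<Rightarrow> real"
  assumes "solid A"
    and esc: "\<And>u. 0 \<le> u \<Longrightarrow> u \<in> ideal_generated A \<Longrightarrow> \<exists>x\<in>A. \<epsilon> \<le> \<rho> (sup (\<bar>x\<bar> - u) 0)"
  obtains s where "\<And>n. 0 \<le> s n" and "\<And>n. s n \<le> s (Suc n)"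
    and "\<And>n. s (Suc n) - s n \<in> A"
    and "\<And>n. \<epsilon> \<le> \<rho> (sup (s (Suc n) - s n - 4 ^ n *\<^sub>R s n) 0)"
proof -
  let ?I = "ideal_generated A"
  have sub: "subspace ?I" using order_ideal_ideal_generated by (auto simp: order_ideal_def)
  have "A \<subseteq> ?I" unfolding ideal_generated_def by (rule hull_subset)
  let ?P = "\<lambda>n s. 0 \<le> s \<and> s \<in> ?I"
  let ?Q = "\<lambda>n s t. s \<le> t \<and> t - s \<in> A \<and> \<epsilon> \<le> \<rho> (sup (t - s - 4 ^ n *\<^sub>R s) 0)"
  have "\<exists>s. \<forall>n. ?P n (s n) \<and> ?Q n (s n) (s (Suc n))"
  proof (rule dependent_nat_choice)
    show "\<exists>s. ?P 0 s" using subspace_0[OF sub] by blast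
    fix s and n :: nat assume s: "?P n s"
    have "0 \<le> (4 ^ n :: real) *\<^sub>R s" "(4 ^ n :: real) *\<^sub>R s \<in> ?I"
      using s by (auto intro: scaleR_nonneg_nonneg subspace_scale[OF sub])
    then obtain x where x: "x \<in> A" "\<epsilon> \<le> \<rho> (sup (\<bar>x\<bar> - 4 ^ n *\<^sub>R s) 0)"
      using esc by blast
    have absx: "\<bar>x\<bar> \<in> A" using \<open>solid A\<close> x(1) by (auto simp: solid_def)
    then have "?P (Suc n) (s + \<bar>x\<bar>)"
      using s \<open>A \<subseteq> ?I\<close> by (auto intro: subspace_add[OF sub])
    moreover have "?Q n s (s + \<bar>x\<bar>)" using x absx by simp
    ultimately show "\<exists>t. ?P (Suc n) t \<and> ?Q n s t" by blast
  qed
  then show ?thesis using that by blast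
qed

text \<open>For \<open>m < n\<close> the scaling constant witnessing disjointness is \<open>2\<^sup>m\<^sup>+\<^sup>n\<close>: on one side
  \<open>4\<^sup>n s\<^sub>n \<ge> 2\<^sup>m\<^sup>+\<^sup>n y\<^sub>m\<close>, on the other \<open>2\<^sup>-\<^sup>m z \<ge> 2\<^sup>-\<^sup>m\<^sup>-\<^sup>n y\<^sub>n\<close>, where \<open>y\<close> denotes the increments of \<open>s\<close>.\<close>

lemma disjoint_truncations:
  fixes s :: "nat \<Rightarrow> 'a::banach_lattice"
  assumes nonneg: "\<And>n. 0 \<le> s n" and incr: "\<And>n. s n \<le> s (Suc n)"
    and dom: "\<And>n. (1 / 2 ^ n) *\<^sub>R (s (Suc n) - s n) \<le> z"
  shows "disjoint_seq (\<lambda>n. sup (s (Suc n) - s n - 4 ^ n *\<^sub>R s n - (1 / 2 ^ n) *\<^sub>R z) 0)"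
    (is "disjoint_seq ?d")
proof -
  define y where "y n = s (Suc n) - s n" for n
  have y: "0 \<le> y n" for n using incr by (simp add: y_def)
  have z: "0 \<le> z"
    using order_trans[OF y[of 0], of z] dom[of 0] by (simp add: y_def)
  have disj: "inf (?d n) (?d m) = 0" if "m < n" for m n
  proof (rule antisym)
    define c where "c = (2::real) ^ (m + n)"
    have c1: "1 \<le> c" unfolding c_def by (rule one_le_power) simp
    have "c \<le> 2 ^ (n + n)" unfolding c_def using that by (intro power_increasing) auto
    then have c4: "c \<le> 4 ^ n" by (simp add: power_add flip: power_mult_distrib)
    have "s (Suc m) \<le> s n" using that by (intro lift_Suc_mono_le[of s, OF incr]) simp
    then have "y m \<le> s n" using add_mono[OF _ nonneg[of m], of "s (Suc m)" "s n"]
      by (simp add: y_def algebra_simps)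
    then have "c *\<^sub>R y m \<le> 4 ^ n *\<^sub>R s n"
      using c4 c1 y by (intro scaleR_mono) auto
    moreover have "0 \<le> (1 / 2 ^ n :: real) *\<^sub>R z" using z by (simp add: scaleR_nonneg_nonneg)
    ultimately have "c *\<^sub>R y m + 0 \<le> 4 ^ n *\<^sub>R s n + (1 / 2 ^ n) *\<^sub>R z" by (rule add_mono)
    then have "y n - 4 ^ n *\<^sub>R s n - (1 / 2 ^ n) *\<^sub>R z \<le> y n - c *\<^sub>R y m"
      by (simp add: algebra_simps)
    then have n: "?d n \<le> sup (y n - c *\<^sub>R y m) 0"
      unfolding y_def by (intro sup_mono) auto
    have "(1 / 2 ^ m :: real) *\<^sub>R ((1 / 2 ^ n) *\<^sub>R y n) \<le> (1 / 2 ^ m) *\<^sub>R z"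
      using dom by (intro scaleR_left_mono) (auto simp: y_def)
    then have "(1 / c) *\<^sub>R y n \<le> (1 / 2 ^ m) *\<^sub>R z"
      by (simp add: c_def power_add)
    moreover have "0 \<le> (4 ^ m :: real) *\<^sub>R s m" using nonneg by (simp add: scaleR_nonneg_nonneg)
    ultimately have "0 + (1 / c) *\<^sub>R y n \<le> 4 ^ m *\<^sub>R s m + (1 / 2 ^ m) *\<^sub>R z"
      by (intro add_mono)
    then have "y m - 4 ^ m *\<^sub>R s m - (1 / 2 ^ m) *\<^sub>R z \<le> y m - (1 / c) *\<^sub>R y n"
      by (simp add: algebra_simps)
    then have m: "?d m \<le> sup (y m - (1 / c) *\<^sub>R y n) 0"
      unfolding y_def by (intro sup_mono) auto
    show "inf (?d n) (?d m) \<le> 0"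
      using inf_mono[OF n m] unfolding disjoint_pos_parts[OF c1] .
  qed simp
  have "inf (?d n) (?d m) = 0" if "n \<noteq> m" for n m
    using disj[of n m] disj[of m n] that by (cases n m rule: linorder_cases) (auto simp: inf_commute)
  then show ?thesis
    by (auto simp: disjoint_seq_def)
qed

text \<open>Comparing the escaping vectors with their disjoint truncations gives the result for every
  subadditive function bounded by a multiple of the norm.\<close>

lemma subadditive_small_off_ideal:
  fixes A :: "'a::banach_lattice set" and \<rho> :: "'a \<Rightarrow> real"
  assumes "bounded A" and solid: "solid A"
    and subadd: "\<And>a b. \<rho> (a + b) \<le> \<rho> a + \<rho> b"
    and bound: "\<And>a. \<rho> a \<le> C * norm a"
    and null: "\<And>x. (\<And>n. x n \<in> A) \<Longrightarrow> disjoint_seq x \<Longrightarrow> (\<lambda>n. \<rho> (x n)) \<longlonglongrightarrow> 0"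
    and "0 < \<epsilon>"
  shows "\<exists>u\<ge>0. u \<in> ideal_generated A \<and> (\<forall>x\<in>A. \<rho> (sup (\<bar>x\<bar> - u) 0) < \<epsilon>)"
proof (rule ccontr)
  assume "\<not> ?thesis"
  then have "\<exists>x\<in>A. \<epsilon> \<le> \<rho> (sup (\<bar>x\<bar> - u) 0)" if "0 \<le> u" "u \<in> ideal_generated A" for u
    using that by (meson not_le)
  then obtain s where nonneg: "\<And>n. 0 \<le> s n" and incr: "\<And>n. s n \<le> s (Suc n)"
    and inA: "\<And>n. s (Suc n) - s n \<in> A"
    and large: "\<And>n. \<epsilon> \<le> \<rho> (sup (s (Suc n) - s n - 4 ^ n *\<^sub>R s n) 0)"
    using escaping_partial_sums[OF solid] by blast
  define y where "y n = s (Suc n) - s n" for n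
  define w where "w n = sup (y n - 4 ^ n *\<^sub>R s n) 0" for n
  have y: "0 \<le> y n" for n using incr by (simp add: y_def)
  obtain B where B: "\<And>x. x \<in> A \<Longrightarrow> norm x \<le> B"
    using \<open>bounded A\<close> by (auto simp: bounded_iff)
  have summable: "summable (\<lambda>n. (1 / 2 ^ n) *\<^sub>R y n)"
  proof (rule summable_comparison_test')
    show "summable (\<lambda>n. (1 / 2) ^ n * B)" by (intro summable_mult2 summable_geometric) simp
    show "norm ((1 / 2 ^ n) *\<^sub>R y n) \<le> (1 / 2) ^ n * B" for n
      using B[OF inA[of n]] by (simp add: y_def power_one_over divide_right_mono)
  qed
  define z where "z = (\<Sum>n. (1 / 2 ^ n) *\<^sub>R y n)"
  define d where "d n = sup (y n - 4 ^ n *\<^sub>R s n - (1 / 2 ^ n) *\<^sub>R z) 0" for n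
  have le_z: "(1 / 2 ^ n) *\<^sub>R y n \<le> z" for n
    unfolding z_def by (rule term_le_suminf[OF summable]) (simp add: scaleR_nonneg_nonneg y)
  have "0 \<le> z" using le_z[of 0] y[of 0] by simp
  then have zn: "0 \<le> (1 / 2 ^ n :: real) *\<^sub>R z" for n by (simp add: scaleR_nonneg_nonneg)
  have "d n \<in> A" for n
  proof -
    have "0 \<le> (4 ^ n :: real) *\<^sub>R s n" using nonneg by (simp add: scaleR_nonneg_nonneg)
    from add_mono[OF this zn[of n]] have "y n - 4 ^ n *\<^sub>R s n - (1 / 2 ^ n) *\<^sub>R z \<le> y n"
      by (simp add: algebra_simps)
    then have "\<bar>d n\<bar> \<le> \<bar>y n\<bar>" using y by (simp add: d_def)
    then show ?thesis using solid inA by (auto simp: solid_def y_def)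
  qed
  moreover have "disjoint_seq d"
    using disjoint_truncations[of s z] nonneg incr le_z by (simp add: d_def[abs_def] y_def)
  ultimately have "(\<lambda>n. \<rho> (d n)) \<longlonglongrightarrow> 0" by (rule null)
  moreover have "(\<lambda>n. (1 / 2) ^ n * (\<bar>C\<bar> * norm z)) \<longlonglongrightarrow> 0"
    by (intro tendsto_mult_left_zero LIMSEQ_power_zero) simp
  ultimately have "(\<lambda>n. \<rho> (d n) + (1 / 2) ^ n * (\<bar>C\<bar> * norm z)) \<longlonglongrightarrow> 0"
    by (rule tendsto_add_zero)
  moreover have "\<epsilon> \<le> \<rho> (d n) + (1 / 2) ^ n * (\<bar>C\<bar> * norm z)" for n
  proof -
    have "d n \<le> w n"
      using zn[of n] unfolding d_def w_def by (intro sup_mono) auto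
    moreover have "w n \<le> d n + (1 / 2 ^ n) *\<^sub>R z"
      using le_supI2[OF zn[of n]] by (simp add: w_def d_def add_sup_distrib_right)
    ultimately have "norm (w n - d n) \<le> norm ((1 / 2 ^ n) *\<^sub>R z)"
      by (intro norm_mono_pos) (simp_all add: algebra_simps)
    then have small: "norm (w n - d n) \<le> (1 / 2) ^ n * norm z"
      by (simp add: power_one_over)
    have "\<epsilon> \<le> \<rho> (d n + (w n - d n))"
      using large[of n] by (simp add: w_def y_def)
    also have "\<dots> \<le> \<rho> (d n) + C * norm (w n - d n)"
      using subadd bound[of "w n - d n"] by (meson add_left_mono order_trans)
    also have "C * norm (w n - d n) \<le> \<bar>C\<bar> * ((1 / 2) ^ n * norm z)"
      using small by (intro mult_mono) auto
    finally show ?thesis by (simp add: mult_ac)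
  qed
  ultimately have "\<epsilon> \<le> 0"
    by (intro tendsto_lowerbound[where a = \<epsilon>]) auto
  then show False using \<open>0 < \<epsilon>\<close> by simp
qed

lemma subadditive_comp_small_off_ideal:
  fixes A :: "'a::banach_lattice set" and T :: "'a \<Rightarrow> 'c::real_normed_vector" and \<rho> :: "'c \<Rightarrow> real"
  assumes "bounded A" and "solid A" and T: "bounded_linear T"
    and subadd: "\<And>a b. \<rho> (a + b) \<le> \<rho> a + \<rho> b"
    and bound: "\<And>a. \<rho> a \<le> C * norm a" and "0 \<le> C"
    and null: "\<And>x. (\<And>n. x n \<in> A) \<Longrightarrow> disjoint_seq x \<Longrightarrow> (\<lambda>n. \<rho> (T (x n))) \<longlonglongrightarrow> 0"
    and "0 < \<epsilon>"
  shows "\<exists>u\<ge>0. u \<in> ideal_generated A \<and> (\<forall>x\<in>A. \<rho> (T (sup (\<bar>x\<bar> - u) 0)) < \<epsilon>)"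
proof -
  interpret T: bounded_linear T by (rule T)
  obtain K where K: "\<And>x. norm (T x) \<le> norm x * K" using T.bounded by blast
  show ?thesis
  proof (rule subadditive_small_off_ideal[where \<rho> = "\<lambda>x. \<rho> (T x)" and C = "C * K"])
    show "\<rho> (T (a + b)) \<le> \<rho> (T a) + \<rho> (T b)" for a b
      by (simp add: T.add subadd)
    show "\<rho> (T a) \<le> C * K * norm a" for a
    proof -
      have "\<rho> (T a) \<le> C * norm (T a)" by (rule bound)
      also have "\<dots> \<le> C * (norm a * K)" using K \<open>0 \<le> C\<close> by (intro mult_left_mono)
      finally show ?thesis by (simp add: mult_ac)
    qed
  qed (use assms in auto)
qed


section \<open>The functionals measuring unbounded convergence\<close>

lemma dual_apply_mono:
  assumes "0 \<le> y'" "a \<le> b"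
  shows "dual_apply y' a \<le> dual_apply y' b"
proof -
  have "0 \<le> dual_apply y' (b - a)"
    using assms by (auto simp: less_eq_dual_def)
  then show ?thesis by (simp add: dual_apply_right)
qed

lemma rho_un_add_le:
  assumes "0 \<le> v"
  shows "rho_un v (a + b) \<le> rho_un v a + rho_un v b"
proof -
  have "rho_un v (a + b) \<le> norm (inf \<bar>a\<bar> v + inf \<bar>b\<bar> v)"
    unfolding rho_un_def using assms by (intro norm_mono_pos inf_abs_add_le) auto
  also have "\<dots> \<le> rho_un v a + rho_un v b"
    unfolding rho_un_def by (rule norm_triangle_ineq)
  finally show ?thesis .
qed

lemma rho_un_le: "0 \<le> v \<Longrightarrow> rho_un v a \<le> 1 * norm a"
  by (simp add: rho_un_def norm_inf_abs_le)

lemma rho_uaw_add_le: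
  assumes "0 \<le> v" "0 \<le> y'"
  shows "rho_uaw v y' (a + b) \<le> rho_uaw v y' a + rho_uaw v y' b"
  using dual_apply_mono[OF assms(2) inf_abs_add_le[OF assms(1)]]
  by (simp add: rho_uaw_def dual_apply_right)

lemma rho_uaw_le:
  assumes "0 \<le> v"
  shows "rho_uaw v y' a \<le> norm y' * norm a"
proof -
  have "rho_uaw v y' a \<le> norm y' * norm (inf \<bar>a\<bar> v)"
    unfolding rho_uaw_def using abs_dual_apply_le[of y' "inf \<bar>a\<bar> v"] by simp
  also have "\<dots> \<le> norm y' * norm a"
    using assms by (intro mult_left_mono norm_inf_abs_le) auto
  finally show ?thesis .
qed

lemma rho_uaws_add_le:
  assumes "0 \<le> v'" "0 \<le> y"
  shows "rho_uaws v' y (a + b) \<le> rho_uaws v' y a + rho_uaws v' y b"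
  using inf_abs_add_le[OF assms(1), of a b] assms(2)
  by (simp add: rho_uaws_def less_eq_dual_def)

lemma rho_uaws_le:
  assumes "0 \<le> v'"
  shows "rho_uaws v' y a \<le> norm y * norm a"
proof -
  have "rho_uaws v' y a \<le> norm (inf \<bar>a\<bar> v') * norm y"
    unfolding rho_uaws_def using abs_dual_apply_le[of "inf \<bar>a\<bar> v'" y] by simp
  also have "\<dots> \<le> norm a * norm y"
    using assms by (intro mult_right_mono norm_inf_abs_le) auto
  finally show ?thesis by (simp add: mult_ac)
qed

theorem corollary2p3:
  fixes A :: "'a::banach_lattice set"
  assumes "bounded A" and "solid A"
  shows
    "(\<forall>T :: 'a \<Rightarrow> 'b::banach_lattice.
        bounded_linear T \<longrightarrow>
        (\<forall>x. (\<forall>n. x n \<in> A) \<longrightarrow> disjoint_seq x \<longrightarrow> un_null (\<lambda>n. T (x n))) \<longrightarrow>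
        (\<forall>\<epsilon>>0. \<forall>v\<ge>0. \<exists>u\<ge>0. u \<in> ideal_generated A \<and>
          (\<forall>x\<in>A. rho_un v (T (sup (\<bar>x\<bar> - u) 0)) < \<epsilon>)))
   \<and> (\<forall>T :: 'a \<Rightarrow> 'b.
        bounded_linear T \<longrightarrow>
        (\<forall>x. (\<forall>n. x n \<in> A) \<longrightarrow> disjoint_seq x \<longrightarrow> uaw_null (\<lambda>n. T (x n))) \<longrightarrow>
        (\<forall>\<epsilon>>0. \<forall>v\<ge>0. \<forall>y'\<ge>0. \<exists>u\<ge>0. u \<in> ideal_generated A \<and>
          (\<forall>x\<in>A. rho_uaw v y' (T (sup (\<bar>x\<bar> - u) 0)) < \<epsilon>)))
   \<and> (\<forall>T :: 'a \<Rightarrow> 'b dual.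
        bounded_linear T \<longrightarrow>
        (\<forall>x. (\<forall>n. x n \<in> A) \<longrightarrow> disjoint_seq x \<longrightarrow> uaws_null (\<lambda>n. T (x n))) \<longrightarrow>
        (\<forall>\<epsilon>>0. \<forall>v'\<ge>0. \<forall>y\<ge>0. \<exists>u\<ge>0. u \<in> ideal_generated A \<and>
          (\<forall>x\<in>A. rho_uaws v' y (T (sup (\<bar>x\<bar> - u) 0)) < \<epsilon>)))"
proof (intro conjI allI impI)
  fix T :: "'a \<Rightarrow> 'b" and \<epsilon> :: real and v :: 'b
  assume "bounded_linear T" "0 < \<epsilon>" and "0 \<le> v"
    and "\<forall>x. (\<forall>n. x n \<in> A) \<longrightarrow> disjoint_seq x \<longrightarrow> un_null (\<lambda>n. T (x n))"
  then show "\<exists>u\<ge>0. u \<in> ideal_generated A \<and> (\<forall>x\<in>A. rho_un v (T (sup (\<bar>x\<bar> - u) 0)) < \<epsilon>)"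
    by (intro subadditive_comp_small_off_ideal[where C = 1] assms)
      (auto simp: un_null_def rho_un_add_le intro: order_trans[OF rho_un_le])
next
  fix T :: "'a \<Rightarrow> 'b" and \<epsilon> :: real and v :: 'b and y' :: "'b dual"
  assume "bounded_linear T" "0 < \<epsilon>" and "0 \<le> v" "0 \<le> y'"
    and "\<forall>x. (\<forall>n. x n \<in> A) \<longrightarrow> disjoint_seq x \<longrightarrow> uaw_null (\<lambda>n. T (x n))"
  then show "\<exists>u\<ge>0. u \<in> ideal_generated A \<and> (\<forall>x\<in>A. rho_uaw v y' (T (sup (\<bar>x\<bar> - u) 0)) < \<epsilon>)"
    by (intro subadditive_comp_small_off_ideal[where C = "norm y'"] assms)
      (auto simp: uaw_null_def rho_uaw_add_le rho_uaw_le)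
next
  fix T :: "'a \<Rightarrow> 'b dual" and \<epsilon> :: real and v' :: "'b dual" and y :: 'b
  assume "bounded_linear T" "0 < \<epsilon>" and "0 \<le> v'" "0 \<le> y"
    and "\<forall>x. (\<forall>n. x n \<in> A) \<longrightarrow> disjoint_seq x \<longrightarrow> uaws_null (\<lambda>n. T (x n))"
  then show "\<exists>u\<ge>0. u \<in> ideal_generated A \<and> (\<forall>x\<in>A. rho_uaws v' y (T (sup (\<bar>x\<bar> - u) 0)) < \<epsilon>)"
    by (intro subadditive_comp_small_off_ideal[where C = "norm y"] assms)
      (auto simp: uaws_null_def rho_uaws_add_le rho_uaws_le)
qed

end
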